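(* Let $G$ be a finite simple graph and let $T$ be a minimum twin cover of $G$, with image $\widetilde T = \{[x]: x\in T\}$ in the quotient graph $\widetilde G$. Among all determining sets for $\widetilde G$ that contain $\widetilde T$, let $\widetilde S$ be one of minimum size. Let \[ S = T \cup \{x \in V(G) \mid [x] \in \widetilde S \setminus \widetilde T\}. \] Then $S$ is a minimum size determining set for $G$. In particular, if $\widetilde S = \widetilde T$, then $T$ is a minimum size determining set for $G$.
   Context: Two vertices are twins if they have the same open neighborhood. Define $x \sim y$ if $x = y$ or $x,y$ are twins; this is an equivalence relation with classes $[x]$. The quotient graph $\widetilde G$ has the equivalence classes as vertices, with $[x]$ adjacent to $[z]$ iff $x$ is adjacent to $z$ in $G$. A minimum twin cover of $G$ is a minimum size subset of $V(G)$ containing at least one vertex from every pair of twin vertices. A set $S$ of vertices of a graph $H$ is a determining set if the only automorphism of $H$ fixing every vertex of $S$ is the identity. *)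

theory Defs
  imports "Graph_Theory.Graph_Theory" "HOL-Combinatorics.Permutations"
begin

(* Finite simple graphs are the locale pair_graph: finite, loopfree, with a symmetric
   arc relation "parcs G" on the vertex set "pverts G". *)

definition neighborhood :: "'a pair_pre_digraph \<Rightarrow> 'a \<Rightarrow> 'a set" where
  "neighborhood G x = {y \<in> pverts G. (x, y) \<in> parcs G}"

definition twins :: "'a pair_pre_digraph \<Rightarrow> 'a \<Rightarrow> 'a \<Rightarrow> bool" where
  "twins G x y \<longleftrightarrow> x \<in> pverts G \<and> y \<in> pverts G \<and> x \<noteq> y \<and> neighborhood G x = neighborhood G y"

definition twin_rel :: "'a pair_pre_digraph \<Rightarrow> 'a rel" where
  "twin_rel G = {(x, y). x \<in> pverts G \<and> y \<in> pverts G \<and> (x = y \<or> twins G x y)}"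

definition twin_class :: "'a pair_pre_digraph \<Rightarrow> 'a \<Rightarrow> 'a set" where
  "twin_class G x = twin_rel G `` {x}"

definition twin_quotient :: "'a pair_pre_digraph \<Rightarrow> 'a set pair_pre_digraph" where
  "twin_quotient G =
    \<lparr> pverts = pverts G // twin_rel G,
      parcs = {(twin_class G x, twin_class G z) | x z. (x, z) \<in> parcs G} \<rparr>"

definition twin_cover :: "'a pair_pre_digraph \<Rightarrow> 'a set \<Rightarrow> bool" where
  "twin_cover G T \<longleftrightarrow> T \<subseteq> pverts G \<and> (\<forall>x y. twins G x y \<longrightarrow> x \<in> T \<or> y \<in> T)"

(* Since "f permutes pverts G" makes f the identity outside the vertex set,
   distinct f are distinct automorphisms and the identity automorphism is id. *)
definition automorphism :: "'a pair_pre_digraph \<Rightarrow> ('a \<Rightarrow> 'a) \<Rightarrow> bool" where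
  "automorphism G f \<longleftrightarrow> f permutes pverts G \<and>
    (\<forall>x\<in>pverts G. \<forall>y\<in>pverts G. (f x, f y) \<in> parcs G \<longleftrightarrow> (x, y) \<in> parcs G)"

definition determining_set :: "'a pair_pre_digraph \<Rightarrow> 'a set \<Rightarrow> bool" where
  "determining_set G S \<longleftrightarrow> S \<subseteq> pverts G \<and>
    (\<forall>f. automorphism G f \<and> (\<forall>x\<in>S. f x = x) \<longrightarrow> f = id)"

lemma twin_rel_iff:
  "(x, y) \<in> twin_rel G \<longleftrightarrow>
    x \<in> pverts G \<and> y \<in> pverts G \<and> neighborhood G x = neighborhood G y"
  unfolding twin_rel_def twins_def by blast

lemma equiv_twin_rel: "equiv (pverts G) (twin_rel G)"
proof (rule equivI)
  show "twin_rel G \<subseteq> pverts G \<times> pverts G" by (auto simp: twin_rel_def)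
  show "refl_on (pverts G) (twin_rel G)" by (simp add: refl_on_def twin_rel_iff)
  show "sym (twin_rel G)" by (rule symI) (simp add: twin_rel_iff)
  show "trans (twin_rel G)" by (rule transI) (simp add: twin_rel_iff)
qed

(* Adjacency of twin classes does not depend on the choice of representatives. *)
lemma twin_quotient_arc_iff:
  assumes "pair_graph G" "x \<in> pverts G" "z \<in> pverts G"
  shows "(twin_class G x, twin_class G z) \<in> parcs (twin_quotient G) \<longleftrightarrow> (x, z) \<in> parcs G"
proof
  interpret pair_graph G by fact
  have sym: "(v, u) \<in> parcs G" if "(u, v) \<in> parcs G" for u v
    using pair_sym_arcs that by (auto simp: symmetric_def sym_def)
  have same: "(u, w) \<in> parcs G \<longleftrightarrow> (v, w) \<in> parcs G"
    if "v \<in> pverts G" "twin_class G u = twin_class G v" for u v w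
  proof -
    have "v \<in> twin_class G v" using that(1) by (simp add: twin_class_def twin_rel_iff)
    then have "(u, v) \<in> twin_rel G" using that(2) by (auto simp: twin_class_def)
    then have "neighborhood G u = neighborhood G v"
      by (simp add: twin_rel_iff)
    then show ?thesis using in_arcsD2 unfolding neighborhood_def by blast
  qed
  assume "(twin_class G x, twin_class G z) \<in> parcs (twin_quotient G)"
  then obtain u w where "(u, w) \<in> parcs G"
    "twin_class G u = twin_class G x" "twin_class G w = twin_class G z"
    by (auto simp: twin_quotient_def)
  then show "(x, z) \<in> parcs G" using same[OF assms(2)] same[OF assms(3)] sym by blast
next
  assume "(x, z) \<in> parcs G"
  then show "(twin_class G x, twin_class G z) \<in> parcs (twin_quotient G)"
    by (auto simp: twin_quotient_def)
qed

lemma pair_graph_twin_quotient: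
  assumes "pair_graph G"
  shows "pair_graph (twin_quotient G)"
proof -
  interpret pair_graph G by fact
  have arcE: "\<exists>x z. e = (twin_class G x, twin_class G z) \<and> (x, z) \<in> parcs G
      \<and> x \<in> pverts G \<and> z \<in> pverts G" if "e \<in> parcs (twin_quotient G)" for e
  proof -
    from that obtain x z where "e = (twin_class G x, twin_class G z)" "(x, z) \<in> parcs G"
      by (auto simp: twin_quotient_def)
    then show ?thesis using in_arcsD1 in_arcsD2 by blast
  qed
  have cls: "twin_class G x \<in> pverts (twin_quotient G)" if "x \<in> pverts G" for x
    using that by (auto simp: twin_quotient_def twin_class_def intro: quotientI)
  have fin: "finite (pverts (twin_quotient G))"
  proof -
    have "twin_rel G \<subseteq> pverts G \<times> pverts G" by (auto simp: twin_rel_def)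
    with pair_finite_verts have "finite (pverts G // twin_rel G)" by (rule finite_quotient)
    then show ?thesis by (simp add: twin_quotient_def)
  qed
  have sub: "parcs (twin_quotient G) \<subseteq> pverts (twin_quotient G) \<times> pverts (twin_quotient G)"
    using arcE cls by blast
  have symG: "(v, u) \<in> parcs G" if "(u, v) \<in> parcs G" for u v
    using pair_sym_arcs that by (auto simp: symmetric_def sym_def)
  show ?thesis
  proof unfold_locales
    show "finite (parcs (twin_quotient G))"
      using finite_subset[OF sub] fin by blast
    show "symmetric (with_proj (twin_quotient G))"
    proof -
      have "(b, a) \<in> parcs (twin_quotient G)" if "(a, b) \<in> parcs (twin_quotient G)" for a b
        using arcE[OF that] symG by (auto simp: twin_quotient_def)
      then show ?thesis by (auto simp: symmetric_def intro: symI)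
    qed
  next
    show "finite (pverts (twin_quotient G))" by (rule fin)
  next
    fix e assume e: "e \<in> parcs (twin_quotient G)"
    then show "fst e \<in> pverts (twin_quotient G)" "snd e \<in> pverts (twin_quotient G)"
      using sub by (metis mem_Times_iff subsetD)+
    from e obtain x z where xz: "e = (twin_class G x, twin_class G z)" "(x, z) \<in> parcs G"
      "x \<in> pverts G" "z \<in> pverts G" using arcE by blast
    show "fst e \<noteq> snd e"
    proof
      assume "fst e = snd e"
      then have "(twin_class G x, twin_class G x) \<in> parcs (twin_quotient G)"
        using e xz(1) by simp
      then have "(x, x) \<in> parcs G" using twin_quotient_arc_iff[OF assms xz(3) xz(3)] by blast
      then show False using pair_no_loops[of "(x, x)"] by simp
    qed
  qed
qed

end

theory Submission
  imports Defs
begin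

text \<open>
  Every determining set \<open>D\<close> of \<open>G\<close> is a twin cover, since exchanging two twins is an
  automorphism. Split \<open>D\<close> into the part inside the set \<open>N\<close> of vertices that have a twin and the
  part outside. The first is again a twin cover, so it has at least \<open>card T\<close> elements. The second
  embeds into the quotient, because vertices outside \<open>N\<close> have singleton classes. An automorphism of
  the quotient that fixes all nontrivial classes permutes the singleton classes and so lifts to \<open>G\<close>;
  hence the image of \<open>D\<close> is a determining set of the quotient containing the image of \<open>T\<close>.
  Conversely, an automorphism of \<open>G\<close> that fixes \<open>S\<close> induces an automorphism of the quotient fixing
  \<open>S'\<close>, so it preserves every class, and a twin cover leaves no room to move inside a class.
\<close>

section \<open>Twin classes and twin covers\<close>

definition twin_vertices :: "'a pair_pre_digraph \<Rightarrow> 'a set" where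
  "twin_vertices G = {x. \<exists>y. twins G x y}"

lemma twins_sym: "twins G x y \<Longrightarrow> twins G y x"
  by (auto simp: twins_def)

lemma twin_vertices_subset: "twin_vertices G \<subseteq> pverts G"
  by (auto simp: twin_vertices_def twins_def)

lemma mem_twin_class_iff:
  "y \<in> twin_class G x \<longleftrightarrow> x \<in> pverts G \<and> y \<in> pverts G \<and> neighborhood G x = neighborhood G y"
  by (simp add: twin_class_def twin_rel_iff)

lemma twin_class_eq_iff:
  assumes "x \<in> pverts G" "y \<in> pverts G"
  shows "twin_class G x = twin_class G y \<longleftrightarrow> x = y \<or> twins G x y"
  using assms by (auto simp: set_eq_iff mem_twin_class_iff twins_def)

lemma pverts_twin_quotient: "pverts (twin_quotient G) = twin_class G ` pverts G"
  by (auto simp: twin_quotient_def quotient_def twin_class_def)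

lemma inj_on_twin_class: "inj_on (twin_class G) (pverts G - twin_vertices G)"
  by (rule inj_onI) (auto simp: twin_class_eq_iff twin_vertices_def)

lemma twin_class_notin_image_twin_vertices:
  assumes "x \<in> pverts G - twin_vertices G"
  shows "twin_class G x \<notin> twin_class G ` twin_vertices G"
proof
  assume "twin_class G x \<in> twin_class G ` twin_vertices G"
  then obtain y where y: "y \<in> twin_vertices G" "twin_class G x = twin_class G y" by blast
  then have "x = y \<or> twins G x y"
    using assms twin_vertices_subset[of G] by (subst twin_class_eq_iff[symmetric]) auto
  then show False using assms y by (auto simp: twin_vertices_def)
qed

lemma twin_class_image_minus_twin_vertices:
  "twin_class G ` (pverts G - twin_vertices G) =
    pverts (twin_quotient G) - twin_class G ` twin_vertices G"
  using twin_class_notin_image_twin_vertices[of _ G]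
  by (auto simp: pverts_twin_quotient)

text \<open>Both members of a twin pair lie in \<open>twin_vertices G\<close>, so vertices of
  \<open>D\<close> outside that set cover nothing.\<close>

lemma twin_cover_Int_twin_vertices:
  "twin_cover G D \<Longrightarrow> twin_cover G (D \<inter> twin_vertices G)"
  unfolding twin_cover_def twin_vertices_def using twins_sym by fastforce

text \<open>Twins share their class, so it does not matter which vertex of a twin pair the cover
  picks.\<close>

lemma twin_cover_covers_classes:
  assumes "twin_cover G D"
  shows "twin_class G ` twin_vertices G \<subseteq> twin_class G ` D"
proof
  fix c assume "c \<in> twin_class G ` twin_vertices G"
  then obtain x y where xy: "twins G x y" "c = twin_class G x"
    by (auto simp: twin_vertices_def)
  then have "c = twin_class G y"
    using twin_class_eq_iff[of x G y] by (auto simp: twins_def)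
  moreover have "x \<in> D \<or> y \<in> D" using xy assms by (simp add: twin_cover_def)
  ultimately show "c \<in> twin_class G ` D" using xy by blast
qed

text \<open>Discarding the vertices without a twin leaves a twin cover; by minimality nothing was
  discarded.\<close>

lemma minimum_twin_cover_subset_twin_vertices:
  assumes "finite (pverts G)" "is_arg_min card (twin_cover G) T"
  shows "T \<subseteq> twin_vertices G"
proof -
  have T: "twin_cover G T" and min: "\<And>U. twin_cover G U \<Longrightarrow> card T \<le> card U"
    using assms(2) by (auto simp: is_arg_min_def not_less)
  have "finite T" using T assms(1) finite_subset by (auto simp: twin_cover_def)
  then have "T \<inter> twin_vertices G = T"
    using min[OF twin_cover_Int_twin_vertices[OF T]] by (intro card_seteq) auto
  then show ?thesis by blast
qed

section \<open>Automorphisms of the graph and of its quotient\<close>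

context
  fixes G :: "'a pair_pre_digraph"
  assumes pg: "pair_graph G"
begin

interpretation pair_graph G by (rule pg)

lemma neighborhood_eq_arcs: "neighborhood G x = {y. (x, y) \<in> parcs G}"
  using in_arcsD2 by (auto simp: neighborhood_def)

lemma arc_sym: "(x, y) \<in> parcs G \<longleftrightarrow> (y, x) \<in> parcs G"
  using pair_sym_arcs by (auto simp: symmetric_def sym_def)

text \<open>Equal neighborhoods and symmetry let \<open>a\<close> and \<open>b\<close> replace each
  other in either argument of the arc relation, even in an arc between the two.\<close>

lemma automorphism_transpose_twins:
  assumes "twins G a b"
  shows "automorphism G (transpose a b)"
proof -
  have ab: "a \<in> pverts G" "b \<in> pverts G" "a \<noteq> b" using assms by (auto simp: twins_def)
  have nb: "(a, z) \<in> parcs G \<longleftrightarrow> (b, z) \<in> parcs G" for z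
    using assms by (auto simp: twins_def neighborhood_eq_arcs)
  have nb': "(z, a) \<in> parcs G \<longleftrightarrow> (z, b) \<in> parcs G" for z
    using nb arc_sym by blast
  have "(transpose a b x, transpose a b y) \<in> parcs G \<longleftrightarrow> (x, y) \<in> parcs G" for x y
    using ab(3) by (simp add: transpose_def nb nb')
  then show ?thesis using ab by (auto simp: automorphism_def permutes_swap_id)
qed

lemma determining_set_imp_twin_cover:
  assumes "determining_set G D"
  shows "twin_cover G D"
  unfolding twin_cover_def
proof (intro conjI allI impI)
  show "D \<subseteq> pverts G" using assms by (simp add: determining_set_def)
  fix a b assume ab: "twins G a b"
  show "a \<in> D \<or> b \<in> D"
  proof (rule ccontr)
    assume "\<not> (a \<in> D \<or> b \<in> D)"
    then have "\<forall>x\<in>D. transpose a b x = x" by (auto simp: transpose_def)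
    then have "transpose a b = id"
      using assms automorphism_transpose_twins[OF ab] by (auto simp: determining_set_def)
    then have "transpose a b a = a" by simp
    with ab show False by (simp add: twins_def)
  qed
qed

lemma automorphism_image_neighborhood:
  assumes f: "automorphism G f" and x: "x \<in> pverts G"
  shows "neighborhood G (f x) = f ` neighborhood G x"
proof -
  have V: "f ` pverts G = pverts G"
    using f by (simp add: automorphism_def permutes_image)
  have "neighborhood G (f x) = {y \<in> f ` pverts G. (f x, y) \<in> parcs G}"
    by (simp add: neighborhood_def V)
  also have "\<dots> = f ` neighborhood G x"
    using f x by (auto simp: neighborhood_def automorphism_def)
  finally show ?thesis .
qed

lemma automorphism_image_twin_class:
  assumes f: "automorphism G f" and x: "x \<in> pverts G"
  shows "f ` twin_class G x = twin_class G (f x)"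
proof -
  have V: "f ` pverts G = pverts G" and inj: "inj f"
    using f by (auto simp: automorphism_def permutes_image permutes_inj)
  have "twin_class G (f x) = {y \<in> f ` pverts G. neighborhood G (f x) = neighborhood G y}"
    using V x by (auto simp: mem_twin_class_iff)
  also have "\<dots> = f ` {y \<in> pverts G. neighborhood G (f x) = neighborhood G (f y)}"
    by blast
  also have "\<dots> = f ` {y \<in> pverts G. neighborhood G x = neighborhood G y}"
    using inj x by (auto simp: automorphism_image_neighborhood[OF f] inj_image_eq_iff)
  also have "\<dots> = f ` twin_class G x"
    using x by (auto simp: mem_twin_class_iff)
  finally show ?thesis by simp
qed

text \<open>The image map sends the class of \<open>x\<close> to the class of \<open>f x\<close>.
  The \<open>else\<close> branch supplies the identity off the vertex set that
  \<open>permutes\<close> demands.\<close>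

lemma automorphism_twin_quotient_induced:
  assumes f: "automorphism G f"
  shows "automorphism (twin_quotient G)
    (\<lambda>c. if c \<in> pverts (twin_quotient G) then f ` c else c)" (is "automorphism ?Q ?g")
proof -
  have perm: "f permutes pverts G" using f by (simp add: automorphism_def)
  have cls: "?g (twin_class G x) = twin_class G (f x)" if "x \<in> pverts G" for x
    using that automorphism_image_twin_class[OF f] by (auto simp: pverts_twin_quotient)
  have fx: "f x \<in> pverts G" if "x \<in> pverts G" for x
    using that perm by (simp add: permutes_in_image)
  have into: "?g ` pverts ?Q \<subseteq> pverts ?Q"
    using cls fx by (auto simp: pverts_twin_quotient)
  have inj: "inj_on ?g (pverts ?Q)"
    using permutes_inj[OF perm] by (auto intro!: inj_onI simp: inj_image_eq_iff)
  \<comment> \<open>Surjectivity is free: an injective self-map of a finite set is onto.\<close>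
  have "finite (pverts ?Q)" by (simp add: pverts_twin_quotient)
  then have "?g ` pverts ?Q = pverts ?Q"
    using into inj by (rule endo_inj_surj)
  then have "?g permutes pverts ?Q"
    using inj by (intro bij_imp_permutes) (auto simp: bij_betw_def)
  moreover have "(?g c, ?g d) \<in> parcs ?Q \<longleftrightarrow> (c, d) \<in> parcs ?Q"
    if cd: "c \<in> pverts ?Q" "d \<in> pverts ?Q" for c d
  proof -
    obtain x y where xy: "x \<in> pverts G" "y \<in> pverts G" "c = twin_class G x" "d = twin_class G y"
      using cd by (auto simp: pverts_twin_quotient)
    then show ?thesis
      using f fx by (simp only: cls twin_quotient_arc_iff[OF pg]) (simp add: automorphism_def)
  qed
  ultimately show ?thesis unfolding automorphism_def by blast
qed

lemma automorphism_lift_twin_quotient: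
  assumes g: "automorphism (twin_quotient G) g"
    and fixed: "\<And>c. c \<in> twin_class G ` twin_vertices G \<Longrightarrow> g c = c"
  obtains f where "automorphism G f"
    and "\<And>x. x \<in> pverts G \<Longrightarrow> twin_class G (f x) = g (twin_class G x)"
    and "\<And>x. x \<in> twin_vertices G \<Longrightarrow> f x = x"
proof -
  let ?N = "twin_vertices G" and ?W = "pverts G - twin_vertices G" and ?Q = "twin_quotient G"
  let ?R = "twin_class G ` ?W"
  \<comment> \<open>On vertices without twins the class map is injective, so \<open>h\<close> turns
    a singleton class back into its vertex; \<open>f\<close> is \<open>g\<close> conjugated by this
    bijection.\<close>
  define h where "h = the_inv_into ?W (twin_class G)"
  define f where "f x = (if x \<in> ?W then h (g (twin_class G x)) else x)" for x
  have gperm: "g permutes pverts ?Q" using g by (simp add: automorphism_def)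
  have bij1: "bij_betw (twin_class G) ?W ?R"
    using inj_on_twin_class by (simp add: bij_betw_def)
  \<comment> \<open>As \<open>g\<close> permutes all classes and fixes the nontrivial ones, it
    permutes the remaining ones, namely \<open>?R\<close>.\<close>
  have "g ` (pverts ?Q - twin_class G ` ?N) = g ` pverts ?Q - g ` (twin_class G ` ?N)"
    using permutes_inj[OF gperm] by (rule image_set_diff)
  moreover have "g ` (twin_class G ` ?N) = twin_class G ` ?N"
    using fixed by (simp cong: image_cong)
  ultimately have "g ` ?R = ?R"
    by (simp only: twin_class_image_minus_twin_vertices permutes_image[OF gperm])
  then have bij2: "bij_betw g ?R ?R"
    using permutes_inj[OF gperm] by (auto simp: bij_betw_def intro: inj_on_subset)
  have bij3: "bij_betw h ?R ?W"
    unfolding h_def using bij1 by (rule bij_betw_the_inv_into)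
  have "bij_betw (h \<circ> (g \<circ> twin_class G)) ?W ?W"
    by (rule bij_betw_trans[OF bij_betw_trans[OF bij1 bij2] bij3])
  moreover have "bij_betw f ?W ?W = bij_betw (h \<circ> (g \<circ> twin_class G)) ?W ?W"
    by (rule bij_betw_cong) (simp add: f_def)
  ultimately have "bij_betw f ?W ?W" by blast
  then have "f permutes ?W"
    by (rule bij_imp_permutes) (auto simp: f_def)
  then have perm: "f permutes pverts G"
    by (rule permutes_subset) blast
  have cls: "twin_class G (f x) = g (twin_class G x)" if "x \<in> pverts G" for x
  proof (cases "x \<in> ?N")
    case True
    then show ?thesis by (simp add: f_def fixed)
  next
    case False
    then have "g (twin_class G x) \<in> ?R"
      using that bij2 by (auto simp: bij_betw_def)
    then show ?thesis
      using False that f_the_inv_into_f[OF inj_on_twin_class, of _ G]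
      by (simp add: f_def h_def)
  qed
  have "(f x, f y) \<in> parcs G \<longleftrightarrow> (x, y) \<in> parcs G" if xy: "x \<in> pverts G" "y \<in> pverts G" for x y
  proof -
    \<comment> \<open>Adjacency depends only on classes, so it can be tested in the quotient, where
      \<open>g\<close> preserves it.\<close>
    have "(f x, f y) \<in> parcs G \<longleftrightarrow> (g (twin_class G x), g (twin_class G y)) \<in> parcs ?Q"
      using xy perm by (simp add: twin_quotient_arc_iff[OF pg, symmetric] cls permutes_in_image)
    also have "\<dots> \<longleftrightarrow> (twin_class G x, twin_class G y) \<in> parcs ?Q"
      using g xy by (simp add: automorphism_def pverts_twin_quotient)
    also have "\<dots> \<longleftrightarrow> (x, y) \<in> parcs G"
      using xy by (rule twin_quotient_arc_iff[OF pg])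
    finally show ?thesis .
  qed
  with perm have "automorphism G f" by (simp add: automorphism_def)
  then show ?thesis using cls by (rule that) (auto simp: f_def)
qed

section \<open>Transfer of determining sets between the graph and its quotient\<close>

lemma determining_set_image_twin_quotient:
  assumes D: "determining_set G D"
  shows "determining_set (twin_quotient G) (twin_class G ` D)"
  unfolding determining_set_def
proof (intro conjI allI impI)
  show "twin_class G ` D \<subseteq> pverts (twin_quotient G)"
    using D by (auto simp: determining_set_def pverts_twin_quotient)
  fix g assume g: "automorphism (twin_quotient G) g \<and> (\<forall>c\<in>twin_class G ` D. g c = c)"
  \<comment> \<open>This makes \<open>g\<close> fix every nontrivial class, as the lift
    requires.\<close>
  have cover: "twin_class G ` twin_vertices G \<subseteq> twin_class G ` D"
    using determining_set_imp_twin_cover[OF D] by (rule twin_cover_covers_classes)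
  obtain f where f: "automorphism G f"
    and cls: "\<And>x. x \<in> pverts G \<Longrightarrow> twin_class G (f x) = g (twin_class G x)"
    and fN: "\<And>x. x \<in> twin_vertices G \<Longrightarrow> f x = x"
  proof (rule automorphism_lift_twin_quotient)
    show "automorphism (twin_quotient G) g" using g by blast
    show "g c = c" if "c \<in> twin_class G ` twin_vertices G" for c
      using that g cover by blast
  qed blast
  have "f x = x" if "x \<in> D" for x
  proof (cases "x \<in> twin_vertices G")
    case False
    have x: "x \<in> pverts G" using that D by (auto simp: determining_set_def)
    moreover have "f x \<in> pverts G"
      using f x by (simp add: automorphism_def permutes_in_image)
    moreover have "twin_class G x = twin_class G (f x)"
      unfolding cls[OF x] using that g by simp
    ultimately have "x = f x \<or> twins G x (f x)"
      by (simp only: twin_class_eq_iff[symmetric])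
    moreover have "\<not> twins G x (f x)" using False by (auto simp: twin_vertices_def)
    ultimately show ?thesis by metis
  qed (rule fN)
  then have "f = id" using D f by (auto simp: determining_set_def)
  then have "g (twin_class G x) = twin_class G x" if "x \<in> pverts G" for x
    using cls[OF that] by simp
  then have "g c = c" if "c \<in> pverts (twin_quotient G)" for c
    using that by (auto simp: pverts_twin_quotient)
  moreover have "g c = c" if "c \<notin> pverts (twin_quotient G)" for c
    using that g by (auto simp: automorphism_def permutes_not_in)
  ultimately show "g = id" by (auto simp: fun_eq_iff)
qed

lemma determining_set_of_quotient:
  assumes T: "twin_cover G T" "T \<subseteq> S" and S: "S \<subseteq> pverts G"
    and det: "determining_set (twin_quotient G) (twin_class G ` S)"
  shows "determining_set G S"
  unfolding determining_set_def
proof (intro conjI allI impI)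
  show "S \<subseteq> pverts G" by (rule S)
  fix f assume "automorphism G f \<and> (\<forall>x\<in>S. f x = x)"
  then have f: "automorphism G f" and fS: "\<And>x. x \<in> S \<Longrightarrow> f x = x" by auto
  have perm: "f permutes pverts G" using f by (simp add: automorphism_def)
  let ?g = "\<lambda>c. if c \<in> pverts (twin_quotient G) then f ` c else c"
  have cls: "?g (twin_class G x) = twin_class G (f x)" if "x \<in> pverts G" for x
    using that automorphism_image_twin_class[OF f] by (auto simp: pverts_twin_quotient)
  have "?g c = c" if c: "c \<in> twin_class G ` S" for c
  proof -
    obtain x where x: "x \<in> S" "c = twin_class G x" using c by blast
    have "?g c = twin_class G (f x)" unfolding x(2) using x(1) S by (intro cls) blast
    then show ?thesis using x fS by simp
  qed
  then have gid: "?g = id"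
    using det automorphism_twin_quotient_induced[OF f] by (simp only: determining_set_def) blast
  have "f x = x" if x: "x \<in> pverts G" for x
  proof (rule ccontr)
    assume ne: "f x \<noteq> x"
    have "twin_class G (f x) = twin_class G x"
      using cls[OF x] fun_cong[OF gid, of "twin_class G x"] by simp
    moreover have "f x \<in> pverts G" using perm x by (simp add: permutes_in_image)
    ultimately have "f x = x \<or> twins G (f x) x"
      using x by (simp only: twin_class_eq_iff[symmetric])
    with ne have "x \<in> T \<or> f x \<in> T" using T(1) by (auto simp: twin_cover_def)
    \<comment> \<open>If \<open>x\<close> is in \<open>T\<close>, then already
      \<open>f x = x\<close>; if \<open>f x\<close> is in \<open>T\<close>, then \<open>f\<close>
      fixes it. Injectivity contradicts \<open>ne\<close> in both cases.\<close>
    then have "f (f x) = f x" using T(2) fS by auto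
    with ne show False using permutes_inj[OF perm] by (simp add: inj_eq)
  qed
  moreover have "f x = x" if "x \<notin> pverts G" for x
    using perm that by (simp add: permutes_not_in)
  ultimately show "f = id" by (auto simp: fun_eq_iff)
qed

end

section \<open>The cardinality comparison\<close>

theorem theorem5:
  fixes G :: "'a pair_pre_digraph"
    and T S :: "'a set"
    and T' S' :: "'a set set"
  assumes "pair_graph G"
    and "is_arg_min card (twin_cover G) T"
    and "T' = twin_class G ` T"
    and "is_arg_min card (\<lambda>U. determining_set (twin_quotient G) U \<and> T' \<subseteq> U) S'"
    and "S = T \<union> {x \<in> pverts G. twin_class G x \<in> S' - T'}"
  shows "is_arg_min card (determining_set G) S \<and>
    (S' = T' \<longrightarrow> is_arg_min card (determining_set G) T)"
proof -
  interpret pair_graph G by fact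
  let ?N = "twin_vertices G"
  have T: "twin_cover G T" and Tmin: "\<And>U. twin_cover G U \<Longrightarrow> card T \<le> card U"
    using assms(2) by (auto simp: is_arg_min_def not_less)
  have S': "determining_set (twin_quotient G) S'" "T' \<subseteq> S'"
    and S'min: "\<And>U. determining_set (twin_quotient G) U \<Longrightarrow> T' \<subseteq> U \<Longrightarrow> card S' \<le> card U"
    using assms(4) by (auto simp: is_arg_min_def not_less)
  have TN: "T \<subseteq> ?N"
    using pair_finite_verts assms(2) by (rule minimum_twin_cover_subset_twin_vertices)
  \<comment> \<open>So \<open>T'\<close> is the set of all nontrivial classes, whichever minimum
    twin cover was chosen.\<close>
  have T'N: "T' = twin_class G ` ?N"
    using TN twin_cover_covers_classes[OF T] unfolding assms(3) by blast
  have S'V: "S' \<subseteq> twin_class G ` pverts G"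
    using S'(1) by (simp add: determining_set_def pverts_twin_quotient)
  define R where "R = {x \<in> pverts G. twin_class G x \<in> S' - T'}"
  have SR: "S = T \<union> R" by (simp add: assms(5) R_def)
  have R: "R \<subseteq> pverts G - ?N" using T'N by (auto simp: R_def)
  have clsR: "twin_class G ` R = S' - T'" using S'V by (auto simp: R_def)
  have clsS: "twin_class G ` S = S'"
    using S'(2) clsR assms(3) by (auto simp: SR image_Un)
  have SV: "S \<subseteq> pverts G" using T R by (auto simp: SR twin_cover_def)
  have fin: "finite D" if "D \<subseteq> pverts G" for D
    using that pair_finite_verts finite_subset by blast
  have finS': "finite S'" using fin[OF SV] clsS by blast
  have "determining_set G S"
    using determining_set_of_quotient[OF assms(1) T, of S] SV S'(1) by (simp add: SR clsS[unfolded SR])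
  moreover have "card S \<le> card D" if D: "determining_set G D" for D
  proof -
    have cov: "twin_cover G D"
      using determining_set_imp_twin_cover[OF assms(1) D] .
    then have DV: "D \<subseteq> pverts G" by (simp add: twin_cover_def)
    have T'D: "T' \<subseteq> twin_class G ` D"
      unfolding T'N using cov by (rule twin_cover_covers_classes)
    \<comment> \<open>The image of \<open>D\<close> competes with \<open>S'\<close>. Both contain
      \<open>T'\<close>, so the truncated subtractions below are genuine cardinalities of
      differences.\<close>
    have "card R = card (S' - T')"
      unfolding clsR[symmetric] using R
      by (intro card_image[symmetric] inj_on_subset[OF inj_on_twin_class])
    also have "\<dots> = card S' - card T'"
      using S'(2) finS' by (meson card_Diff_subset finite_subset)
    also have "\<dots> \<le> card (twin_class G ` D) - card T'"
      using S'min[OF determining_set_image_twin_quotient[OF assms(1) D] T'D] by simp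
    also have "\<dots> = card (twin_class G ` D - T')"
      using T'D fin[OF DV] by (metis card_Diff_subset finite_imageI finite_subset)
    \<comment> \<open>A class of a vertex of \<open>D\<close> that is not in \<open>T'\<close> must
      come from a vertex without a twin.\<close>
    also have "\<dots> \<le> card (twin_class G ` (D - ?N))"
      using fin[OF DV] by (intro card_mono) (auto simp: T'N)
    also have "\<dots> \<le> card (D - ?N)"
      using fin[OF DV] by (intro card_image_le) auto
    finally have "card R \<le> card (D - ?N)" .
    moreover have "card T \<le> card (D \<inter> ?N)"
      using Tmin twin_cover_Int_twin_vertices[OF cov] by blast
    moreover have "card D = card (D \<inter> ?N) + card (D - ?N)"
      using fin[OF DV] by (simp flip: card_Int_Diff)
    moreover have "card S \<le> card T + card R" unfolding SR by (rule card_Un_le)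
    ultimately show ?thesis by linarith
  qed
  ultimately have min: "is_arg_min card (determining_set G) S"
    by (auto simp: is_arg_min_def not_less)
  moreover have "S = T" if "S' = T'"
    using that by (simp add: assms(5))
  ultimately show ?thesis by blast
qed

end
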